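(* Let $t,w,v$ be positive integers, let $(\mathcal{X},\mathcal{B})$ be a $t$-TS$(w,v)$, and let $B\in\mathcal{B}$. The number of $\lceil w/t^2\rceil$-own-subsets of $B$ is at least $\binom{w-1}{\lceil w/t^2\rceil-1}$.
   Context: A set system is a pair $(\mathcal{X},\mathcal{B})$ where $\mathcal{X}$ is a finite set of points and $\mathcal{B}$ is a collection (set) of subsets of $\mathcal{X}$ called blocks. $\binom{\mathcal{X}}{w}$ denotes the collection of all $w$-subsets of $\mathcal{X}$. A $t$-traceability scheme $t$-TS$(w,v)$ is a set system $(\mathcal{X},\mathcal{B})$ with $|\mathcal{X}|=v$ and $\mathcal{B}\subseteq\binom{\mathcal{X}}{w}$ such that for every choice of $s$ blocks $B_1,\ldots,B_s\in\mathcal{B}$ with $1\le s\le t$ and for any $w$-subset $T\subseteq\bigcup_{1\le j\le s}B_j$, there does not exist a block $B\in\mathcal{B}\setminus\{B_1,\ldots,B_s\}$ such that $|T\cap B|\ge|T\cap B_j|$ for all $1\le j\le s$. In a set system $(\mathcal{X},\mathcal{B})$ with $B\in\mathcal{B}$, a subset $B_0\subseteq B$ is called a $|B_0|$-own-subset of $B$ if $B_0\nsubseteq B'$ for every $B'\in\mathcal{B}\setminus\{B\}$. *)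

theory Defs
  imports Complex_Main
begin

definition set_system :: "'a set \<Rightarrow> 'a set set \<Rightarrow> bool" where
  "set_system X \<B> \<longleftrightarrow> finite X \<and> \<B> \<subseteq> Pow X"

definition subsets_of_size :: "'a set \<Rightarrow> nat \<Rightarrow> 'a set set" where
  "subsets_of_size X w = {A. A \<subseteq> X \<and> card A = w}"

(* The chosen blocks are an indexed family C 1, ..., C s; repetitions are allowed
   (restricting to distinct blocks would give the same notion, since only
   the set of chosen blocks matters and s ranges over all of 1, ..., t). *)
definition traceability_scheme ::
  "nat \<Rightarrow> nat \<Rightarrow> nat \<Rightarrow> 'a set \<Rightarrow> 'a set set \<Rightarrow> bool" where
  "traceability_scheme t w v X \<B> \<longleftrightarrow>
     set_system X \<B> \<and> card X = v \<and> \<B> \<subseteq> subsets_of_size X w \<and>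
     (\<forall>(s::nat) (C :: nat \<Rightarrow> 'a set) T.
        1 \<le> s \<and> s \<le> t \<and> (\<forall>j\<in>{1..s}. C j \<in> \<B>) \<and>
        T \<in> subsets_of_size (\<Union>j\<in>{1..s}. C j) w \<longrightarrow>
        \<not> (\<exists>B \<in> \<B> - C ` {1..s}. \<forall>j\<in>{1..s}. card (T \<inter> B) \<ge> card (T \<inter> C j)))"

definition own_subset :: "nat \<Rightarrow> 'a set set \<Rightarrow> 'a set \<Rightarrow> 'a set \<Rightarrow> bool" where
  "own_subset k \<B> B B\<^sub>0 \<longleftrightarrow>
     B\<^sub>0 \<subseteq> B \<and> card B\<^sub>0 = k \<and> (\<forall>B' \<in> \<B> - {B}. \<not> B\<^sub>0 \<subseteq> B')"

end

(* In a t-traceability scheme no block B is covered by t^2 other blocks: averaging over cyclic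
   arcs would give t of the covering blocks that cover much of B with little overlap, and a
   suitably chosen block among B and these t could then be framed by the other t.  Hence, for
   k = ceil (w / t^2), every cover of B by at most t^2 of its k-subsets contains an own-subset,
   and Katona's cycle method bounds from below the size of a family of k-subsets that meets all
   such covers. *)
theory Submission
  imports Defs "HOL-Combinatorics.Permutations" "HOL-Number_Theory.Cong"
begin

section \<open>Rotations of a cycle\<close>

lemma inj_on_rotate_mod:
  fixes a n :: nat
  shows "inj_on (\<lambda>i. (i + a) mod n) {..<n}"
proof (rule inj_onI)
  fix i j assume "i \<in> {..<n}" "j \<in> {..<n}" "(i + a) mod n = (j + a) mod n"
  then have "[i = j] (mod n)"
    by (simp add: cong_def [symmetric] cong_add_rcancel_nat)
  with \<open>i \<in> {..<n}\<close> \<open>j \<in> {..<n}\<close> show "i = j"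
    by (simp add: cong_less_modulus_unique_nat)
qed

lemma card_rotate_preimage_le:
  fixes a n :: nat
  assumes "finite D"
  shows "card {i \<in> {..<n}. (i + a) mod n \<in> D} \<le> card D"
  by (rule card_inj_on_le[OF inj_on_subset[OF inj_on_rotate_mod[of a n]]])
    (use assms in auto)

text \<open>Otherwise \<open>H\<close> is closed under cyclic predecessors, and walking back from
  \<open>d\<close> brings \<open>k\<close> into \<open>H\<close>.\<close>

lemma exists_cyclic_boundary:
  fixes n :: nat
  assumes d: "d \<in> H" "d < n" and k: "k \<notin> H" "k < n"
  obtains i where "i < n" "i \<notin> H" "Suc i mod n \<in> H"
proof (rule ccontr)
  assume "\<not> thesis"
  with that have closed: "Suc i mod n \<in> H \<Longrightarrow> i < n \<Longrightarrow> i \<in> H" for i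
    by blast
  have "i < n \<Longrightarrow> (i + j) mod n = d \<Longrightarrow> i \<in> H" for i j
  proof (induction j arbitrary: i)
    case 0
    then show ?case using d by simp
  next
    case (Suc j)
    have "(Suc i mod n + j) mod n = d"
      using Suc.prems(2) by (simp add: mod_simps)
    then have "Suc i mod n \<in> H"
      using Suc.IH[of "Suc i mod n"] Suc.prems(1) by simp
    then show ?case using closed Suc.prems(1) by blast
  qed
  \<comment> \<open>Going forward \<open>n - k + d\<close> places from \<open>k\<close> passes once
    through \<open>0\<close> and ends at \<open>d\<close>.\<close>
  from this[of k "n - k + d"] k d show False by simp
qed

text \<open>Lengthening the arcs by one place adds the predecessors of all good starting points.
  Unless every point is already good, the boundary lemma makes one of these new.\<close>

lemma card_arcs_meeting_ge:
  fixes n :: nat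
  assumes D: "D \<subseteq> {..<n}" "D \<noteq> {}"
  shows "min n (card D + t) \<le> card {i \<in> {..<n}. \<exists>a<Suc t. (i + a) mod n \<in> D}"
proof (induction t)
  case 0
  have "{i \<in> {..<n}. \<exists>a<Suc 0. (i + a) mod n \<in> D} = D"
    using D by auto
  then show ?case by simp
next
  case (Suc t)
  define H where "H = (\<lambda>t. {i \<in> {..<n}. \<exists>a<Suc t. (i + a) mod n \<in> D})"
  have sub: "H t \<subseteq> H (Suc t)" and fin: "finite (H (Suc t))"
    by (auto simp: H_def less_Suc_eq)
  have IH: "min n (card D + t) \<le> card (H t)"
    using Suc.IH by (simp add: H_def)
  have "min n (card D + Suc t) \<le> card (H (Suc t))"
  proof (cases "H t = {..<n}")
    case True
    then have "n \<le> card (H (Suc t))"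
      using card_mono[OF fin sub] by simp
    then show ?thesis by simp
  next
    case False
    obtain k where k: "k \<notin> H t" "k < n"
      using False by (auto simp: H_def)
    obtain d where d: "d \<in> D" "d < n"
      using D by auto
    then have "d \<in> H t" by (auto simp: H_def intro!: exI[of _ 0])
    then obtain i where i: "i < n" "i \<notin> H t" "Suc i mod n \<in> H t"
      using exists_cyclic_boundary d k by metis
    then obtain a where a: "a < Suc t" "(Suc i mod n + a) mod n \<in> D"
      by (auto simp: H_def)
    then have "(i + Suc a) mod n \<in> D" by (simp add: mod_simps)
    with a(1) i(1) have "i \<in> H (Suc t)"
      by (auto simp: H_def intro!: exI[of _ "Suc a"])
    with sub have "insert i (H t) \<subseteq> H (Suc t)" by blast
    then have "card (insert i (H t)) \<le> card (H (Suc t))"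
      by (rule card_mono[OF fin])
    moreover have "card (insert i (H t)) = Suc (card (H t))"
      using i(2) finite_subset[OF sub fin] by simp
    ultimately show ?thesis using IH by simp
  qed
  then show ?case by (simp add: H_def)
qed

text \<open>The pointwise estimate for the averaging, with \<open>D\<close> the positions of the
  covering blocks through one point. It rests on \<open>n \<le> t\<^sup>2\<close>: if
  \<open>h \<ge> d + t - 1\<close> with \<open>d = card D \<ge> 1\<close>, then
  \<open>(t + 1) * h\<close> is at least \<open>t * d + t\<^sup>2\<close>.\<close>

lemma arcs_meeting_weight:
  fixes n t :: nat
  assumes D: "D \<subseteq> {..<n}" "D \<noteq> {}" and t: "1 \<le> t" and n: "n \<le> t\<^sup>2"
  shows "n + t * card D \<le> (t + 1) * card {i \<in> {..<n}. \<exists>a<t. (i + a) mod n \<in> D}"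
proof -
  define h where "h = card {i \<in> {..<n}. \<exists>a<t. (i + a) mod n \<in> D}"
  have h: "min n (card D + (t - 1)) \<le> h"
    using card_arcs_meeting_ge[OF D, of "t - 1"] t by (simp add: h_def)
  have Dn: "card D \<le> n" using card_mono[OF _ D(1)] by simp
  have "1 \<le> card D"
    using D finite_subset[OF D(1)] by (simp add: Suc_le_eq card_gt_0_iff)
  have "n + t * card D \<le> (t + 1) * h"
  proof (cases "n \<le> h")
    case True
    have "n + t * card D \<le> n + t * n" using Dn by simp
    also have "\<dots> = (t + 1) * n" by simp
    also have "\<dots> \<le> (t + 1) * h" using True by (intro mult_left_mono) auto
    finally show ?thesis .
  next
    case False
    then have "card D + (t - 1) \<le> h" using h by simp
    then have "(t + 1) * (card D + (t - 1)) \<le> (t + 1) * h" by (intro mult_left_mono) auto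
    moreover have "(t + 1) * (card D + (t - 1)) + 1 = t * card D + card D + t\<^sup>2"
      using t by (cases t) (auto simp: power2_eq_square algebra_simps)
    ultimately show ?thesis using n \<open>1 \<le> card D\<close> by linarith
  qed
  then show ?thesis by (simp add: h_def)
qed

section \<open>Traceability schemes are cover-free\<close>

lemma sum_card_swap:
  assumes "finite S" "finite T"
  shows "(\<Sum>i\<in>S. card {j \<in> T. R i j}) = (\<Sum>j\<in>T. card {i \<in> S. R i j})"
  using assms by (rule sum_multicount_gen) simp

text \<open>Average over the \<open>n\<close> cyclic arcs of length \<open>t\<close> in a cyclic ordering of the cover.\<close>

lemma exists_heavy_subfamily:
  fixes t :: nat
  assumes "finite B" "finite \<C>" and cover: "B \<subseteq> \<Union>\<C>"
    and t: "1 \<le> t" "t \<le> card \<C>" "card \<C> \<le> t\<^sup>2"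
  obtains \<S> where "\<S> \<subseteq> \<C>" "card \<S> = t"
    "card B + (\<Sum>E\<in>\<S>. card (B \<inter> E)) \<le> (t + 1) * card (B \<inter> \<Union>\<S>)"
proof (rule ccontr)
  assume none: "\<not> thesis"
  define n where "n = card \<C>"
  obtain e where e: "bij_betw e {..<n} \<C>"
    using ex_bij_betw_nat_finite[OF \<open>finite \<C>\<close>] by (auto simp: n_def atLeast0LessThan)
  have n: "0 < n" using t by (simp add: n_def)
  \<comment> \<open>\<open>u i a\<close> is the block at place \<open>a\<close> of the arc that
    starts at \<open>i\<close>.\<close>
  define u where "u = (\<lambda>i a. e ((i + a) mod n))"
  have inj: "inj_on (u i) {..<t}" for i
  proof -
    have "inj_on (\<lambda>a. (i + a) mod n) {..<t}"
      by (rule inj_on_subset[of _ "{..<n}"])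
        (use inj_on_rotate_mod[of i n] t in \<open>auto simp: n_def add.commute\<close>)
    moreover have "inj_on e ((\<lambda>a. (i + a) mod n) ` {..<t})"
      by (rule inj_on_subset[OF bij_betw_imp_inj_on[OF e]]) (use n in auto)
    ultimately show ?thesis
      using comp_inj_on[of "\<lambda>a. (i + a) mod n" "{..<t}" e] by (simp add: u_def comp_def)
  qed
  define D where "D = (\<lambda>x. {j \<in> {..<n}. x \<in> e j})"
  \<comment> \<open>\<open>h x\<close> counts the arcs whose union contains
    \<open>x\<close>.\<close>
  define h where "h = (\<lambda>x. card {i \<in> {..<n}. \<exists>a<t. (i + a) mod n \<in> D x})"
  have mem: "x \<in> u i a \<longleftrightarrow> (i + a) mod n \<in> D x" for x i a
    using n by (simp add: u_def D_def)
  have arc: "(t + 1) * card {x \<in> B. \<exists>a<t. (i + a) mod n \<in> D x}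
      < card B + (\<Sum>a<t. card (B \<inter> u i a))" for i
  proof -
    have "u i ` {..<t} \<subseteq> \<C>"
      using bij_betwE[OF e] n by (auto simp: u_def)
    moreover have "card (u i ` {..<t}) = t" by (simp add: card_image[OF inj])
    ultimately have "\<not> card B + (\<Sum>E\<in>u i ` {..<t}. card (B \<inter> E))
        \<le> (t + 1) * card (B \<inter> \<Union>(u i ` {..<t}))"
      using none that by blast
    moreover have "(\<Sum>E\<in>u i ` {..<t}. card (B \<inter> E)) = (\<Sum>a<t. card (B \<inter> u i a))"
      by (simp add: sum.reindex[OF inj])
    moreover have "B \<inter> \<Union>(u i ` {..<t}) = {x \<in> B. \<exists>a<t. (i + a) mod n \<in> D x}"
      by (auto simp: mem)
    ultimately show ?thesis by simp
  qed
  have "(t + 1) * (\<Sum>x\<in>B. h x) = (\<Sum>i<n. (t + 1) * card {x \<in> B. \<exists>a<t. (i + a) mod n \<in> D x})"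
    unfolding h_def sum_distrib_left[symmetric]
    using sum_card_swap[OF \<open>finite B\<close> finite_lessThan[of n]] by simp
  also have "\<dots> < (\<Sum>i<n. card B + (\<Sum>a<t. card (B \<inter> u i a)))"
    by (rule sum_strict_mono) (use n arc in auto)
  also have "\<dots> = n * card B + (\<Sum>a<t. \<Sum>i<n. card (B \<inter> u i a))"
    by (simp add: sum.distrib sum.swap[of _ "{..<n}"])
  \<comment> \<open>At a fixed place \<open>a\<close> rotation is injective, so a point
    \<open>x\<close> is counted at most \<open>card (D x)\<close> times.\<close>
  also have "(\<Sum>a<t. \<Sum>i<n. card (B \<inter> u i a)) \<le> (\<Sum>a<t. \<Sum>x\<in>B. card (D x))"
  proof (rule sum_mono)
    fix a
    have "(\<Sum>i<n. card (B \<inter> u i a)) = (\<Sum>i<n. card {x \<in> B. (i + a) mod n \<in> D x})"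
      by (intro sum.cong refl arg_cong[of _ _ card]) (auto simp: mem)
    also have "\<dots> = (\<Sum>x\<in>B. card {i \<in> {..<n}. (i + a) mod n \<in> D x})"
      by (rule sum_card_swap) (use \<open>finite B\<close> in auto)
    also have "\<dots> \<le> (\<Sum>x\<in>B. card (D x))"
      by (intro sum_mono card_rotate_preimage_le) (simp add: D_def)
    finally show "(\<Sum>i<n. card (B \<inter> u i a)) \<le> (\<Sum>x\<in>B. card (D x))" .
  qed
  also have "n * card B + (\<Sum>a<t. \<Sum>x\<in>B. card (D x)) = (\<Sum>x\<in>B. n + t * card (D x))"
    by (simp add: sum.distrib sum_distrib_left)
  \<comment> \<open>The pointwise estimate leads back to the initial sum, although one step of the
    chain was strict.\<close>
  also have "\<dots> \<le> (\<Sum>x\<in>B. (t + 1) * h x)"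
    unfolding h_def
  proof (rule sum_mono, rule arcs_meeting_weight)
    fix x assume "x \<in> B"
    then obtain j where "j < n" "x \<in> e j"
      using cover e by (auto simp: bij_betw_def)
    then show "D x \<noteq> {}" by (auto simp: D_def)
  qed (use t in \<open>auto simp: D_def n_def\<close>)
  also have "\<dots> = (t + 1) * (\<Sum>x\<in>B. h x)" by (simp add: sum_distrib_left)
  finally show False by simp
qed

lemma traceability_scheme_block:
  assumes "traceability_scheme t w v X \<B>" "E \<in> \<B>"
  shows "finite E" "card E = w"
  using assms finite_subset
  by (auto simp: traceability_scheme_def set_system_def subsets_of_size_def)

text \<open>The defining property for a finite set of blocks, obtained by enumerating the set as
  \<open>C\<close>.\<close>

lemma traceability_scheme_no_framing:
  assumes ts: "traceability_scheme t w v X \<B>"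
    and \<S>: "\<S> \<subseteq> \<B>" "finite \<S>" "\<S> \<noteq> {}" "card \<S> \<le> t"
    and T: "T \<subseteq> \<Union>\<S>" "card T = w" and F: "F \<in> \<B>" "F \<notin> \<S>"
  obtains E where "E \<in> \<S>" "card (T \<inter> F) < card (T \<inter> E)"
proof -
  obtain C where "bij_betw C {1..card \<S>} \<S>"
    using ex_bij_betw_nat_finite_1[OF \<S>(2)] by blast
  then have C: "C ` {1..card \<S>} = \<S>" by (simp add: bij_betw_def)
  have "1 \<le> card \<S>" using \<S> by (simp add: Suc_le_eq card_gt_0_iff)
  moreover have "\<forall>j\<in>{1..card \<S>}. C j \<in> \<B>" using C \<S>(1) by blast
  moreover have "T \<in> subsets_of_size (\<Union>j\<in>{1..card \<S>}. C j) w"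
    using T C by (simp add: subsets_of_size_def)
  ultimately have "\<not> (\<exists>B \<in> \<B> - C ` {1..card \<S>}. \<forall>j\<in>{1..card \<S>}. card (T \<inter> B) \<ge> card (T \<inter> C j))"
    using ts \<S>(4) unfolding traceability_scheme_def by blast
  then obtain j where "j \<in> {1..card \<S>}" "\<not> card (T \<inter> F) \<ge> card (T \<inter> C j)"
    using C F by blast
  then show thesis using that C by (metis imageI not_le)
qed

text \<open>If some member of the family violated the inequality, take a violating \<open>F\<close> whose part
  \<open>M F\<close> covered by the others is as large as possible.  The others frame \<open>F\<close> with a pirate set
  consisting of \<open>M F\<close> and of private points of the others; each other \<open>E\<close> may contribute
  \<open>min |E - M E| (|M F| - |F \<inter> E|)\<close> of them.  There are enough: otherwise some \<open>E\<close> runs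
  out of private points, so \<open>M E\<close> is larger than \<open>M F\<close>, hence \<open>E\<close> satisfies the inequality, which
  in turn gives \<open>E\<close> alone more than \<open>w - |M F|\<close> admissible private points.\<close>

lemma traceability_scheme_covered_part_le:
  assumes ts: "traceability_scheme t w v X \<B>" and t: "1 \<le> t"
    and \<F>: "\<F> \<subseteq> \<B>" "card \<F> = t + 1" and F: "F \<in> \<F>"
  shows "(t + 1) * card (F \<inter> \<Union>(\<F> - {F})) < w + (\<Sum>E\<in>\<F> - {F}. card (F \<inter> E))"
proof (rule ccontr)
  assume viol: "\<not> ?thesis"
  define M where "M = (\<lambda>F. F \<inter> \<Union>(\<F> - {F}))"
  define good where "good = (\<lambda>F. (t + 1) * card (M F) < w + (\<Sum>E\<in>\<F> - {F}. card (F \<inter> E)))"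
  have fin\<F>: "finite \<F>" using \<F>(2) by (simp add: card_ge_0_finite)
  have blk: "finite E" "card E = w" if "E \<in> \<F>" for E
    using traceability_scheme_block[OF ts] \<F>(1) that by auto
  have fM: "finite (M E)" if "E \<in> \<F>" for E using blk that by (simp add: M_def)
  have Mw: "card (M E) \<le> w" if "E \<in> \<F>" for E
    using card_mono[OF blk(1)[OF that], of "M E"] blk(2)[OF that] by (simp add: M_def)
  have "\<exists>G. (G \<in> \<F> \<and> \<not> good G) \<and> (\<forall>E. E \<in> \<F> \<and> \<not> good E \<longrightarrow> card (M E) \<le> card (M G))"
    by (rule ex_has_greatest_nat[of _ F _ "Suc w"])
      (use F viol Mw in \<open>auto simp: good_def M_def less_Suc_eq_le\<close>)
  then obtain G where G: "G \<in> \<F>" "\<not> good G"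
    and max: "\<And>E. E \<in> \<F> \<Longrightarrow> \<not> good E \<Longrightarrow> card (M E) \<le> card (M G)"
    by blast
  define \<S> where "\<S> = \<F> - {G}"
  have \<S>: "finite \<S>" "card \<S> = t" "\<S> \<subseteq> \<B>"
    using fin\<F> \<F> G by (auto simp: \<S>_def card_Diff_singleton)
  have "\<S> \<noteq> {}" using \<S>(2) t by auto
  define m where "m = card (M G)"
  have mw: "m \<le> w" using Mw[OF G(1)] by (simp add: m_def)
  \<comment> \<open>\<open>r E\<close> is the budget of \<open>E\<close>: with that many private
    points added to \<open>G \<inter> E\<close>, its share of the pirate set is still at most
    \<open>m\<close>.\<close>
  define r where "r = (\<lambda>E. m - card (G \<inter> E))"
  define p where "p = (\<lambda>E. card (E - M E))"
  have b: "card (G \<inter> E) \<le> m" if "E \<in> \<S>" for E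
    unfolding m_def by (rule card_mono) (use that fM[OF G(1)] in \<open>auto simp: M_def \<S>_def\<close>)
  have p: "p E + card (M E) = w" if "E \<in> \<F>" for E
    using card_Diff_subset[OF fM[OF that], of E] card_mono[OF blk(1)[OF that], of "M E"] blk[OF that]
    by (auto simp: p_def M_def)
  have good_private: "w - m < min (p E) (r E)" if E: "E \<in> \<S>" "good E" "p E < r E" for E
  proof -
    have EF: "E \<in> \<F>" "E \<noteq> G" using E by (auto simp: \<S>_def)
    \<comment> \<open>The term for \<open>G\<close> is kept exact and the other \<open>t - 1\<close>
      terms are bounded by \<open>card (M E)\<close>. This gives
      \<open>2 * card (M E) < w + card (E \<inter> G)\<close>, which together with
      \<open>p E < r E\<close> forces \<open>card (M E) < m\<close>.\<close>
    have "(\<Sum>D\<in>\<F> - {E}. card (E \<inter> D)) = card (E \<inter> G) + (\<Sum>D\<in>\<F> - {E} - {G}. card (E \<inter> D))"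
      by (rule sum.remove) (use fin\<F> G EF in auto)
    also have "(\<Sum>D\<in>\<F> - {E} - {G}. card (E \<inter> D)) \<le> card (\<F> - {E} - {G}) * card (M E)"
      by (rule sum_bounded_above[where 'a = nat, unfolded of_nat_id], rule card_mono) (use fM[OF EF(1)] in \<open>auto simp: M_def\<close>)
    also have "card (\<F> - {E} - {G}) = t - 1"
      using fin\<F> EF G \<F>(2) by (simp add: card_Diff_singleton)
    finally have "(t + 1) * card (M E) < w + (card (E \<inter> G) + (t - 1) * card (M E))"
      using E(2) unfolding good_def by linarith
    then have "2 * card (M E) < w + card (E \<inter> G)"
      using t by (cases t) (auto simp: algebra_simps)
    moreover have "E \<inter> G = G \<inter> E" by blast
    ultimately show ?thesis
      using E(3) p[OF EF(1)] b[OF E(1)] mw by (simp add: r_def)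
  qed
  have enough: "w - m \<le> (\<Sum>E\<in>\<S>. min (p E) (r E))"
  proof (rule ccontr)
    assume less: "\<not> ?thesis"
    then have le: "min (p E) (r E) < w - m" if "E \<in> \<S>" for E
      using member_le_sum[of E \<S> "\<lambda>E. min (p E) (r E)"] that \<S>(1) by simp
    \<comment> \<open>As \<open>G\<close> is not good, the budgets alone sum to at least
      \<open>w - m\<close>. A shortage thus needs some \<open>E\<close> with fewer private points
      than its budget.\<close>
    have "(\<Sum>E\<in>\<S>. r E) + (\<Sum>E\<in>\<S>. card (G \<inter> E)) = (\<Sum>E\<in>\<S>. m)"
      unfolding sum.distrib[symmetric] by (rule sum.cong) (auto simp: r_def b)
    also have "\<dots> = t * m" by (simp add: \<S>(2))
    finally have "w \<le> m + (\<Sum>E\<in>\<S>. r E)"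
      using G(2) by (simp add: good_def m_def \<S>_def)
    then have "\<not> (\<Sum>E\<in>\<S>. r E) \<le> (\<Sum>E\<in>\<S>. min (p E) (r E))" using less by linarith
    then obtain E where E: "E \<in> \<S>" "\<not> r E \<le> min (p E) (r E)"
      using sum_mono[of \<S> r "\<lambda>E. min (p E) (r E)"] by blast
    then have "p E < r E" by simp
    note E = E(1) this
    have EF: "E \<in> \<F>" using E by (simp add: \<S>_def)
    have "m < card (M E)" using le[OF E(1)] E(2) p[OF EF] by linarith
    then have "good E" using max[OF EF] by (auto simp: m_def not_le)
    then show False using good_private[OF E(1)] E le[OF E(1)] by simp
  qed
  have "\<exists>Q. Q \<subseteq> E - M E \<and> card Q = min (p E) (r E) \<and> finite Q" if "E \<in> \<S>" for E
    by (rule obtain_subset_with_card_n[of "min (p E) (r E)" "E - M E"]) (auto simp: p_def)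
  then obtain Q where Q: "\<And>E. E \<in> \<S> \<Longrightarrow> Q E \<subseteq> E - M E"
      "\<And>E. E \<in> \<S> \<Longrightarrow> card (Q E) = min (p E) (r E)" "\<And>E. E \<in> \<S> \<Longrightarrow> finite (Q E)"
    by metis
  have Q_other: "x \<notin> D" if "x \<in> Q E" "E \<in> \<S>" "D \<in> \<F>" "D \<noteq> E" for x E D
    using Q(1)[OF that(2)] that by (auto simp: M_def)
  have "card (\<Union>E\<in>\<S>. Q E) = (\<Sum>E\<in>\<S>. card (Q E))"
  proof (rule card_UN_disjoint)
    show "\<forall>i\<in>\<S>. \<forall>j\<in>\<S>. i \<noteq> j \<longrightarrow> Q i \<inter> Q j = {}"
      using Q_other Q(1) by (fastforce simp: \<S>_def)
  qed (use \<S> Q in auto)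
  then have "w - m \<le> card (\<Union>E\<in>\<S>. Q E)" using enough Q(2) by simp
  then obtain Y where Y: "Y \<subseteq> (\<Union>E\<in>\<S>. Q E)" "card Y = w - m" "finite Y"
    by (rule obtain_subset_with_card_n)
  have YG: "Y \<inter> G = {}" using Y(1) Q_other[OF _ _ G(1)] by (auto simp: \<S>_def)
  define T where "T = M G \<union> Y"
  have "M G \<subseteq> \<Union>\<S>" by (auto simp: M_def \<S>_def)
  moreover have "Y \<subseteq> \<Union>\<S>" using Y(1) Q(1) by blast
  ultimately have "T \<subseteq> \<Union>\<S>" by (simp add: T_def)
  moreover have "card T = w"
    using card_Un_disjoint[of "M G" Y] YG Y fM[OF G(1)] mw
    by (auto simp: T_def m_def M_def)
  moreover have "card \<S> \<le> t" "G \<in> \<B>" "G \<notin> \<S>"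
    using \<S>(2) G(1) \<F>(1) by (auto simp: \<S>_def)
  ultimately obtain E where E: "E \<in> \<S>" "card (T \<inter> G) < card (T \<inter> E)"
    using traceability_scheme_no_framing[OF ts \<S>(3,1) \<open>\<S> \<noteq> {}\<close>] by blast
  \<comment> \<open>Private points of other members miss \<open>E\<close>, so \<open>E\<close> meets
    \<open>T\<close> in at most \<open>card (G \<inter> E) + r E = m\<close> points, while
    \<open>G\<close> meets it in at least \<open>m\<close>.\<close>
  have "T \<inter> E \<subseteq> (G \<inter> E) \<union> Q E"
  proof
    fix x assume x: "x \<in> T \<inter> E"
    show "x \<in> (G \<inter> E) \<union> Q E"
    proof (cases "x \<in> Y")
      case True
      then obtain D where "D \<in> \<S>" "x \<in> Q D" using Y(1) by blast
      then show ?thesis using Q_other[of x D E] x E(1) by (auto simp: \<S>_def)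
    qed (use x in \<open>auto simp: T_def M_def\<close>)
  qed
  then have "card (T \<inter> E) \<le> card ((G \<inter> E) \<union> Q E)"
    by (rule card_mono[rotated]) (use Q(3)[OF E(1)] blk[OF G(1)] in auto)
  also have "\<dots> \<le> card (G \<inter> E) + card (Q E)" by (rule card_Un_le)
  also have "\<dots> \<le> m" using Q(2)[OF E(1)] b[OF E(1)] by (simp add: r_def)
  also have "m \<le> card (T \<inter> G)"
    unfolding m_def by (rule card_mono) (use blk[OF G(1)] in \<open>auto simp: T_def M_def\<close>)
  finally show False using E(2) by simp
qed

text \<open>At most \<open>t\<close> covering blocks would frame \<open>B\<close> with
  \<open>B\<close> itself as pirate set. With more of them, a heavy subfamily together with
  \<open>B\<close> contradicts the bound on the covered part.\<close>

theorem traceability_scheme_cover_free: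
  assumes ts: "traceability_scheme t w v X \<B>" and t: "1 \<le> t" and w: "1 \<le> w"
    and B: "B \<in> \<B>" and \<C>: "\<C> \<subseteq> \<B> - {B}" "finite \<C>" "card \<C> \<le> t\<^sup>2"
  shows "\<not> B \<subseteq> \<Union>\<C>"
proof
  assume cover: "B \<subseteq> \<Union>\<C>"
  have blk: "finite B" "card B = w" using traceability_scheme_block[OF ts B] by auto
  show False
  proof (cases "card \<C> \<le> t")
    case True
    have "\<C> \<noteq> {}" using cover blk w by auto
    then obtain E where "E \<in> \<C>" "card (B \<inter> B) < card (B \<inter> E)"
      using traceability_scheme_no_framing[OF ts _ \<C>(2) _ True cover blk(2) B] \<C>(1) by blast
    then show False using card_mono[of B "B \<inter> E"] blk by simp
  next
    case False
    then obtain \<S> where \<S>: "\<S> \<subseteq> \<C>" "card \<S> = t"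
      "card B + (\<Sum>E\<in>\<S>. card (B \<inter> E)) \<le> (t + 1) * card (B \<inter> \<Union>\<S>)"
      using exists_heavy_subfamily[OF blk(1) \<C>(2) cover t] \<C>(3) by (metis nat_le_linear)
    have notin: "B \<notin> \<S>" using \<S>(1) \<C>(1) by blast
    have "finite \<S>" using \<S>(1) \<C>(2) by (rule finite_subset)
    then have "card (insert B \<S>) = t + 1" using notin \<S>(2) by simp
    moreover have "insert B \<S> \<subseteq> \<B>" using B \<S>(1) \<C>(1) by blast
    moreover have "insert B \<S> - {B} = \<S>" using notin by blast
    ultimately show False
      using traceability_scheme_covered_part_le[OF ts t, of "insert B \<S>" B] \<S>(3) blk by simp
  qed
qed

section \<open>Families of subsets meeting every small cover\<close>

lemma exists_permutes_image_eq:
  assumes "finite B" "A \<subseteq> B" "A' \<subseteq> B" "card A = card A'"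
  obtains s where "s permutes B" "s ` A = A'"
proof -
  have fin: "finite A" "finite A'" using assms finite_subset by auto
  obtain f where f: "bij_betw f A A'"
    using finite_same_card_bij[OF fin assms(4)] by blast
  have "card (B - A) = card (B - A')" using assms fin by (simp add: card_Diff_subset)
  then obtain g where g: "bij_betw g (B - A) (B - A')"
    using finite_same_card_bij[of "B - A" "B - A'"] assms(1) by blast
  define s where "s = (\<lambda>x. if x \<in> A then f x else if x \<in> B then g x else x)"
  have sA: "bij_betw s A A'" using f by (rule bij_betw_cong[THEN iffD1, rotated]) (simp add: s_def)
  have sB: "bij_betw s (B - A) (B - A')"
    using g by (rule bij_betw_cong[THEN iffD1, rotated]) (simp add: s_def)
  have "bij_betw s (A \<union> (B - A)) (A' \<union> (B - A'))"
    by (rule bij_betw_combine[OF sA sB]) blast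
  moreover have "A \<union> (B - A) = B" "A' \<union> (B - A') = B" using assms by auto
  ultimately have "s permutes B"
    using assms(2) by (intro bij_imp_permutes) (auto simp: s_def)
  with sA that show thesis by (auto simp: bij_betw_def)
qed

lemma card_permutes_image_eq:
  assumes B: "finite B" and D: "D \<subseteq> B" and A: "A \<subseteq> B" "card A = card D"
  shows "card {p. p permutes B \<and> p ` D = A} * (card B choose card D) = card {p. p permutes B}"
proof -
  define N where "N = (\<lambda>A. {p. p permutes B \<and> p ` D = A})"
  have finN: "finite (N A)" for A
    unfolding N_def by (rule finite_subset[OF _ finite_permutations[OF B]]) auto
  have le: "card (N A1) \<le> card (N A2)"
    if "A1 \<subseteq> B" "A2 \<subseteq> B" "card A1 = card A2" for A1 A2
  proof -
    obtain s where s: "s permutes B" "s ` A1 = A2"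
      using exists_permutes_image_eq[OF B \<open>A1 \<subseteq> B\<close> \<open>A2 \<subseteq> B\<close> \<open>card A1 = card A2\<close>] .
    show ?thesis
    proof (rule card_inj_on_le[of "\<lambda>p. s \<circ> p"])
      show "inj_on (\<lambda>p. s \<circ> p) (N A1)"
        using permutes_inj[OF s(1)] by (auto intro!: inj_onI simp: fun.inj_map_strong inj_def fun_eq_iff)
      show "(\<lambda>p. s \<circ> p) ` N A1 \<subseteq> N A2"
        using s by (auto simp: N_def permutes_compose image_comp[symmetric])
    qed (rule finN)
  qed
  define K where "K = {A. A \<subseteq> B \<and> card A = card D}"
  have finK: "finite K" unfolding K_def using B by simp
  have "{p. p permutes B} = (\<Union>A'\<in>K. N A')"
    using D by (auto simp: N_def K_def card_image permutes_inj_on permutes_in_image subset_iff)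
  also have "card \<dots> = (\<Sum>A'\<in>K. card (N A'))"
    by (rule card_UN_disjoint) (use finK finN in \<open>auto simp: N_def\<close>)
  also have "\<dots> = (\<Sum>A'\<in>K. card (N A))"
    using A by (intro sum.cong refl antisym le) (auto simp: K_def)
  also have "\<dots> = card (N A) * (card B choose card D)"
    using n_subsets[OF B, of "card D"] by (simp add: K_def)
  finally show ?thesis by (simp add: N_def)
qed

text \<open>Katona's cycle method: in every cyclic ordering of \<open>B\<close>, each starting point \<open>i\<close> gives a cover
  of \<open>B\<close> by the arcs of length \<open>k\<close> starting at \<open>i, i + k, \<dots>, i + (r - 1) k\<close>, so at least
  \<open>w / r\<close> of the \<open>w\<close> arcs lie in the family.\<close>

lemma card_blocking_family_ge:
  fixes r k w :: nat
  assumes B: "finite B" "card B = w" and k: "1 \<le> k" "k \<le> w" and rk: "w \<le> r * k" "r * (k - 1) < w"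
    and \<O>: "finite \<O>" "\<And>A. A \<in> \<O> \<Longrightarrow> A \<subseteq> B \<and> card A = k"
    and meets: "\<And>\<K>. \<K> \<subseteq> {A. A \<subseteq> B \<and> card A = k} \<Longrightarrow> card \<K> \<le> r \<Longrightarrow> \<Union>\<K> = B \<Longrightarrow> \<K> \<inter> \<O> \<noteq> {}"
  shows "(w - 1) choose (k - 1) \<le> card \<O>"
proof -
  have w: "0 < w" using k by simp
  obtain e where e: "bij_betw e {..<w} B"
    using ex_bij_betw_nat_finite[OF B(1)] B(2) by (auto simp: atLeast0LessThan)
  define arc where "arc = (\<lambda>i. e ` (\<lambda>a. (i + a) mod w) ` {..<k})"
  have arcB: "arc i \<subseteq> B" for i using e w by (auto simp: arc_def bij_betw_def)
  have arck: "card (arc i) = k" for i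
  proof -
    have "card ((\<lambda>a. (i + a) mod w) ` {..<k}) = card {..<k}"
      by (rule card_image, rule inj_on_subset[of _ "{..<w}"])
        (use inj_on_rotate_mod[of i w] k in \<open>auto simp: add.commute\<close>)
    moreover have "inj_on e ((\<lambda>a. (i + a) mod w) ` {..<k})"
      by (rule inj_on_subset[OF bij_betw_imp_inj_on[OF e]]) (use w in auto)
    ultimately show ?thesis by (simp add: arc_def card_image)
  qed
  define P where "P = {p. p permutes B}"
  have finP: "finite P" using finite_permutations[OF B(1)] by (simp add: P_def)
  have "id \<in> P" by (simp add: P_def permutes_id)
  then have P0: "0 < card P" using finP by (auto simp: card_gt_0_iff)
  have many: "k \<le> card {i \<in> {..<w}. p ` arc i \<in> \<O>}" if "p \<in> P" for p
  proof -
    have pB: "p permutes B" using that by (simp add: P_def)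
    define I where "I = {i \<in> {..<w}. p ` arc i \<in> \<O>}"
    have "{..<w} \<subseteq> (\<Union>l\<in>{..<r}. {i \<in> {..<w}. (i + l * k) mod w \<in> I})"
    proof
      fix i assume i: "i \<in> {..<w}"
      define \<K> where "\<K> = (\<lambda>l. p ` arc ((i + l * k) mod w)) ` {..<r}"
      have "card \<K> \<le> r" using card_image_le[of "{..<r}"] by (simp add: \<K>_def)
      moreover have "\<K> \<subseteq> {A. A \<subseteq> B \<and> card A = k}"
        using arcB arck permutes_in_image[OF pB] permutes_inj_on[OF pB]
        by (auto simp: \<K>_def card_image subset_iff)
      moreover have "\<Union>\<K> = B"
      proof
        show "\<Union>\<K> \<subseteq> B" using calculation(2) by blast
        show "B \<subseteq> \<Union>\<K>"
        proof
          fix y assume "y \<in> B"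
          then obtain x where x: "x \<in> B" "y = p x"
            using permutes_image[OF pB] by blast
          then obtain c where c: "c < w" "x = e c"
            using e by (auto simp: bij_betw_def)
          \<comment> \<open>\<open>a\<close> is the cyclic distance from \<open>i\<close> to
            \<open>c\<close>; its quotient by \<open>k\<close> selects the arc, its remainder the
            place in that arc.\<close>
          define a where "a = (c + (w - i)) mod w"
          have "a < w" using w by (simp add: a_def)
          have ca: "(i + a) mod w = c"
            using i c by (simp add: a_def mod_simps)
          define l where "l = a div k"
          have l: "l < r"
            using \<open>a < w\<close> rk(1) k by (simp add: l_def less_mult_imp_div_less)
          have "((i + l * k) mod w + a mod k) mod w = c"
            using ca div_mult_mod_eq[of a k] by (simp add: l_def mod_simps add.assoc)
          moreover have "a mod k < k" using k by simp
          ultimately have "x \<in> arc ((i + l * k) mod w)"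
            using c(2) by (auto simp: arc_def image_iff intro!: bexI[of _ "a mod k"])
          then show "y \<in> \<Union>\<K>" using x l by (auto simp: \<K>_def)
        qed
      qed
      ultimately obtain l where "l < r" "p ` arc ((i + l * k) mod w) \<in> \<O>"
        using meets[of \<K>] by (auto simp: \<K>_def)
      then show "i \<in> (\<Union>l\<in>{..<r}. {i \<in> {..<w}. (i + l * k) mod w \<in> I})"
        using i w by (auto simp: I_def)
    qed
    then have "w \<le> card (\<Union>l\<in>{..<r}. {i \<in> {..<w}. (i + l * k) mod w \<in> I})"
      using card_mono[of "\<Union>l\<in>{..<r}. {i \<in> {..<w}. (i + l * k) mod w \<in> I}" "{..<w}"] by simp
    also have "\<dots> \<le> (\<Sum>l<r. card {i \<in> {..<w}. (i + l * k) mod w \<in> I})"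
      by (rule card_UN_le) simp
    also have "\<dots> \<le> (\<Sum>l<r. card I)"
      by (intro sum_mono card_rotate_preimage_le) (simp add: I_def)
    finally have "w \<le> r * card I" by simp
    \<comment> \<open>Integrality: \<open>card I\<close> is at least \<open>w / r\<close>, which
      exceeds \<open>k - 1\<close>.\<close>
    with rk(2) have "r * (k - 1) < r * card I" by (rule less_le_trans)
    then have "k - 1 < card I" by simp
    then show ?thesis unfolding I_def by linarith
  qed
  \<comment> \<open>Pairs of a permutation and an arc sent into \<open>\<O>\<close> are counted in
    two ways; each arc is sent to a given member of \<open>\<O>\<close> by a fraction
    \<open>1 / (w choose k)\<close> of all permutations.\<close>
  have "k * card P = (\<Sum>p\<in>P. k)" by simp
  also have "\<dots> \<le> (\<Sum>p\<in>P. card {i \<in> {..<w}. p ` arc i \<in> \<O>})"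
    by (rule sum_mono) (rule many)
  also have "\<dots> = (\<Sum>i<w. card {p \<in> P. p ` arc i \<in> \<O>})"
    by (rule sum_card_swap) (use finP in auto)
  also have "\<dots> = (\<Sum>i<w. \<Sum>A\<in>\<O>. card {p. p permutes B \<and> p ` arc i = A})"
  proof (rule sum.cong)
    fix i
    have "{p \<in> P. p ` arc i \<in> \<O>} = (\<Union>A\<in>\<O>. {p. p permutes B \<and> p ` arc i = A})"
      by (auto simp: P_def)
    also have "card \<dots> = (\<Sum>A\<in>\<O>. card {p. p permutes B \<and> p ` arc i = A})"
      using \<O>(1) finP by (intro card_UN_disjoint) (auto simp: P_def)
    finally show "card {p \<in> P. p ` arc i \<in> \<O>} = \<dots>" .
  qed simp
  finally have "k * card P * (w choose k)
      \<le> (\<Sum>i<w. \<Sum>A\<in>\<O>. card {p. p permutes B \<and> p ` arc i = A}) * (w choose k)"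
    by (rule mult_right_mono) simp
  also have "\<dots> = (\<Sum>i<w. \<Sum>A\<in>\<O>. card {p. p permutes B \<and> p ` arc i = A} * (w choose k))"
    by (simp add: sum_distrib_right)
  also have "\<dots> = (\<Sum>i<w. \<Sum>A\<in>\<O>. card P)"
    using card_permutes_image_eq[OF B(1) arcB] \<O>(2) arck B(2)
    by (intro sum.cong refl) (simp add: P_def)
  also have "\<dots> = w * card \<O> * card P" by simp
  finally have "k * (w choose k) \<le> w * card \<O>"
    using P0 by (simp add: mult.commute mult.left_commute)
  then have "w * ((w - 1) choose (k - 1)) \<le> w * card \<O>"
    using times_binomial_minus1_eq[of k w] k by simp
  then show ?thesis using w by simp
qed

section \<open>Counting the own-subsets of a block\<close>

theorem mainTheorem5:
  fixes t w v :: nat and X :: "'a set" and \<B> :: "'a set set" and B :: "'a set"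
  assumes "t \<ge> 1" and "w \<ge> 1" and "v \<ge> 1"
    and "traceability_scheme t w v X \<B>"
    and "B \<in> \<B>"
  shows "card {B\<^sub>0. own_subset (nat \<lceil>real w / (real t)\<^sup>2\<rceil>) \<B> B B\<^sub>0}
           \<ge> (w - 1) choose (nat \<lceil>real w / (real t)\<^sup>2\<rceil> - 1)"
proof -
  define k where "k = nat \<lceil>real w / (real t)\<^sup>2\<rceil>"
  have t2: "(real t)\<^sup>2 > 0" using assms(1) by simp
  have pos: "real w / (real t)\<^sup>2 > 0" using assms(1,2) by (intro divide_pos_pos) auto
  then have k1: "1 \<le> k" by (simp add: k_def Suc_le_eq)
  \<comment> \<open>The ceiling enters only through \<open>w \<le> t\<^sup>2 * k\<close> and
    \<open>t\<^sup>2 * (k - 1) < w\<close>, the arithmetic conditions of the cycle method for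
    \<open>r = t\<^sup>2\<close>.\<close>
  have "real k \<ge> real w / (real t)\<^sup>2" by (simp add: k_def real_nat_ceiling_ge)
  then have "real w \<le> real (t\<^sup>2 * k)" using t2 by (simp add: pos_divide_le_eq mult.commute)
  then have rk: "w \<le> t\<^sup>2 * k" by (simp only: of_nat_le_iff)
  have "real k < real w / (real t)\<^sup>2 + 1" using pos unfolding k_def by linarith
  then have "real (k - 1) < real w / (real t)\<^sup>2" using k1 by (simp add: of_nat_diff)
  then have "real (t\<^sup>2 * (k - 1)) < real w" using t2 by (simp add: pos_less_divide_eq mult.commute)
  then have rk': "t\<^sup>2 * (k - 1) < w" by (simp only: of_nat_less_iff)
  have "k - 1 \<le> t\<^sup>2 * (k - 1)" using assms(1) by simp
  then have kw: "k \<le> w" using rk' k1 by linarith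
  have blk: "finite B" "card B = w"
    using traceability_scheme_block[OF assms(4,5)] by auto
  have "(w - 1) choose (k - 1) \<le> card {B\<^sub>0. own_subset k \<B> B B\<^sub>0}"
  proof (rule card_blocking_family_ge[OF blk k1 kw rk rk'])
    show "finite {B\<^sub>0. own_subset k \<B> B B\<^sub>0}"
      by (rule finite_subset[of _ "Pow B"]) (use blk in \<open>auto simp: own_subset_def\<close>)
    fix \<K> assume \<K>: "\<K> \<subseteq> {A. A \<subseteq> B \<and> card A = k}" "card \<K> \<le> t\<^sup>2" "\<Union>\<K> = B"
    show "\<K> \<inter> {B\<^sub>0. own_subset k \<B> B B\<^sub>0} \<noteq> {}"
    proof
      assume "\<K> \<inter> {B\<^sub>0. own_subset k \<B> B B\<^sub>0} = {}"
      then have not_own: "\<not> own_subset k \<B> B A" if "A \<in> \<K>" for A using that by blast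
      have "\<exists>B' \<in> \<B> - {B}. A \<subseteq> B'" if "A \<in> \<K>" for A
        using not_own[OF that] subsetD[OF \<K>(1) that] by (simp add: own_subset_def)
      \<comment> \<open>Replacing each non-own subset by another block containing it yields a cover
        of \<open>B\<close> by at most \<open>t\<^sup>2\<close> other blocks.\<close>
      then obtain g where g: "\<And>A. A \<in> \<K> \<Longrightarrow> g A \<in> \<B> - {B} \<and> A \<subseteq> g A"
        by (metis (no_types))
      have "finite \<K>"
        by (rule finite_subset[of _ "Pow B"]) (use \<K>(1) blk(1) in auto)
      then have "finite (g ` \<K>)" "card (g ` \<K>) \<le> t\<^sup>2"
        using card_image_le[of \<K> g] \<K>(2) by auto
      moreover have "g ` \<K> \<subseteq> \<B> - {B}" using g by blast
      moreover have "B \<subseteq> \<Union>(g ` \<K>)" using \<K>(3) g by blast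
      ultimately show False
        using traceability_scheme_cover_free[OF assms(4,1,2,5)] by blast
    qed
  qed (auto simp: own_subset_def)
  then show ?thesis by (simp add: k_def)
qed

end
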